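(* Let $\phi$ be the Laplace exponent of a subordinator with zero drift, and suppose that $H(\lambda)=\phi(\lambda)-\lambda\phi'(\lambda)$ satisfies (L) with constants $\gamma,\lambda_L,C_L$. Then there exists $M\ge1$ such that $$H(\lambda)\asymp\lambda^2(-\phi''(\lambda)),\qquad \lambda>M\lambda_L.$$
   Context: The Laplace exponent of a subordinator $S$ (an increasing $[0,\infty)$-valued Lévy process started at $0$) is the function $\phi$ with $\mathbb{E}e^{-\lambda S_t}=e^{-t\phi(\lambda)}$, $\lambda>0$; it has the form $\phi(\lambda)=b\lambda+\int_{(0,\infty)}(1-e^{-\lambda s})\mu(ds)$ with drift $b\ge0$ and Lévy measure $\mu$ on $(0,\infty)$, $\int_{(0,\infty)}(1\wedge s)\mu(ds)<\infty$. Condition (L) for $f:(0,\infty)\to(0,\infty)$: there exist $\gamma>0$, $\lambda_L\ge0$, $C_L>0$ such that $f(\lambda x)/f(\lambda)\ge C_Lx^\gamma$ for all $\lambda>\lambda_L$, $x\ge1$. $f(\lambda)\asymp g(\lambda)$, $\lambda\in I$, means there exist constants $c_1,c_2>0$ with $c_1f(\lambda)\le g(\lambda)\le c_2f(\lambda)$ for all $\lambda\in I$. *)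

theory Defs
  imports "HOL-Probability.Probability"
begin

text \<open>Processes are indexed by type \<open>real\<close>; only times \<open>t \<ge> 0\<close> matter.\<close>

locale levy_process = prob_space M for M :: "'a measure" +
  fixes S :: "real \<Rightarrow> 'a \<Rightarrow> real"
  assumes random_variable: "\<And>t. 0 \<le> t \<Longrightarrow> random_variable borel (S t)"
    and start_zero: "AE \<omega> in M. S 0 \<omega> = 0"
    and independent_increments:
      "\<And>(n::nat) (t::nat \<Rightarrow> real). \<lbrakk>0 \<le> t 0; \<And>i. i < n \<Longrightarrow> t i < t (Suc i)\<rbrakk> \<Longrightarrow>
         indep_vars (\<lambda>_. borel) (\<lambda>i \<omega>. S (t (Suc i)) \<omega> - S (t i) \<omega>) {..<n}"
    and stationary_increments:
      "\<And>s t. \<lbrakk>0 \<le> s; s \<le> t\<rbrakk> \<Longrightarrow>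
         distr M borel (\<lambda>\<omega>. S t \<omega> - S s \<omega>) = distr M borel (S (t - s))"
    and cadlag:
      "AE \<omega> in M.
         (\<forall>t\<ge>0. ((\<lambda>u. S u \<omega>) \<longlongrightarrow> S t \<omega>) (at_right t)) \<and>
         (\<forall>t>0. \<exists>l. ((\<lambda>u. S u \<omega>) \<longlongrightarrow> l) (at_left t))"

locale subordinator = levy_process +
  assumes nonneg_paths: "AE \<omega> in M. \<forall>t\<ge>0. 0 \<le> S t \<omega>"
    and increasing_paths: "AE \<omega> in M. mono_on {0..} (\<lambda>t. S t \<omega>)"

text \<open>The Laplace exponent is a function on \<open>(0,\<infinity>)\<close>; the values of \<open>\<phi>\<close> elsewhere are irrelevant.\<close>

definition laplace_exponent_of ::
    "'a measure \<Rightarrow> (real \<Rightarrow> 'a \<Rightarrow> real) \<Rightarrow> (real \<Rightarrow> real) \<Rightarrow> bool" where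
  "laplace_exponent_of M S \<phi> \<longleftrightarrow>
     (\<forall>t\<ge>0. \<forall>l>0. (\<integral>\<omega>. exp (- l * S t \<omega>) \<partial>M) = exp (- t * \<phi> l))"

definition levy_measure :: "real measure \<Rightarrow> bool" where
  "levy_measure \<mu> \<longleftrightarrow>
     sets \<mu> = sets (restrict_space borel {0<..}) \<and> (\<integral>\<^sup>+ s. ennreal (min 1 s) \<partial>\<mu>) < \<infinity>"

definition has_drift_levy_measure ::
    "(real \<Rightarrow> real) \<Rightarrow> real \<Rightarrow> real measure \<Rightarrow> bool" where
  "has_drift_levy_measure \<phi> b \<mu> \<longleftrightarrow>
     0 \<le> b \<and> levy_measure \<mu> \<and>
     (\<forall>l>0. \<phi> l = b * l + (\<integral>s. (1 - exp (- l * s)) \<partial>\<mu>))"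

definition H_of :: "(real \<Rightarrow> real) \<Rightarrow> real \<Rightarrow> real" where
  "H_of \<phi> l = \<phi> l - l * deriv \<phi> l"

text \<open>The first conjunct expresses that \<open>f\<close> maps \<open>(0,\<infinity>)\<close> into \<open>(0,\<infinity>)\<close>.\<close>

definition condition_L :: "(real \<Rightarrow> real) \<Rightarrow> real \<Rightarrow> real \<Rightarrow> real \<Rightarrow> bool" where
  "condition_L f \<gamma> l\<^sub>L C\<^sub>L \<longleftrightarrow>
     (\<forall>l>0. 0 < f l) \<and> 0 < \<gamma> \<and> 0 \<le> l\<^sub>L \<and> 0 < C\<^sub>L \<and>
     (\<forall>l>l\<^sub>L. \<forall>x\<ge>1. f (l * x) / f l \<ge> C\<^sub>L * x powr \<gamma>)"

definition comparable_on :: "real set \<Rightarrow> (real \<Rightarrow> real) \<Rightarrow> (real \<Rightarrow> real) \<Rightarrow> bool" where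
  "comparable_on I f g \<longleftrightarrow>
     (\<exists>c\<^sub>1>0. \<exists>c\<^sub>2>0. \<forall>l\<in>I. c\<^sub>1 * f l \<le> g l \<and> g l \<le> c\<^sub>2 * f l)"

end

theory Submission
  imports Defs
begin

text \<open>
  Differentiating under the integral gives \<open>- \<phi>''(\<lambda>) = \<integral> s\<^sup>2 exp (- \<lambda> s) \<mu>(ds)\<close>, a nonincreasing function of
  \<open>\<lambda>\<close>, and \<open>H(\<lambda>) = \<integral> (1 - (1 + \<lambda> s) exp (- \<lambda> s)) \<mu>(ds)\<close>. The inequality \<open>1 + u + u\<^sup>2/2 \<le> exp u\<close>
  then yields \<open>\<lambda>\<^sup>2 (- \<phi>''(\<lambda>)) \<le> 2 H(\<lambda>)\<close> for every \<open>\<lambda> > 0\<close>. Conversely, (L) provides \<open>K > 1\<close> with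
  \<open>2 H(\<lambda>) \<le> H(K \<lambda>)\<close> for \<open>\<lambda> > \<lambda>\<^sub>L\<close>. Since \<open>H'(\<lambda>) = - \<lambda> \<phi>''(\<lambda>)\<close>, the mean value theorem on
  \<open>[\<lambda>, K \<lambda>]\<close> gives \<open>H(\<lambda>) \<le> H(K \<lambda>) - H(\<lambda>) \<le> K (K - 1) \<lambda>\<^sup>2 (- \<phi>''(\<lambda>))\<close>. Hence \<open>M = 1\<close> works.
\<close>

section \<open>Exponential bounds and differentiation under the integral sign\<close>

lemma power_div_fact_le_exp:
  fixes u :: real
  assumes "0 \<le> u"
  shows "u ^ k / fact k \<le> exp u"
proof -
  have "(\<Sum>n\<in>{k}. u ^ n /\<^sub>R fact n) \<le> (\<Sum>n. u ^ n /\<^sub>R fact n)"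
    using assms by (intro sum_le_suminf summable_exp_generic) auto
  then show ?thesis
    by (simp add: exp_def divide_inverse mult.commute)
qed

text \<open>Taylor's formula of order two with Lagrange remainder, made crude on purpose: the factor
  \<open>exp \<bar>v\<bar>\<close> is later absorbed by part of the decay of an exponential
  weight.\<close>

lemma exp_quadratic_remainder:
  fixes v :: real
  shows "\<bar>exp v - 1 - v\<bar> \<le> v\<^sup>2 * exp \<bar>v\<bar>"
proof -
  obtain t where t: "\<bar>t\<bar> \<le> \<bar>v\<bar>" "exp v = (\<Sum>m<2. v ^ m / fact m) + exp t / fact 2 * v ^ 2"
    using Maclaurin_exp_le by blast
  have "exp v - 1 - v = exp t / 2 * v\<^sup>2"
    using t(2) by (simp add: numeral_2_eq_2)
  moreover have "exp t / 2 \<le> exp \<bar>v\<bar>"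
    using t(1) exp_le_cancel_iff[of t "\<bar>v\<bar>"] exp_gt_zero[of t] by linarith
  then have "exp t / 2 * v\<^sup>2 \<le> exp \<bar>v\<bar> * v\<^sup>2"
    by (rule mult_right_mono) simp
  moreover have "0 \<le> exp t / 2 * v\<^sup>2" by simp
  ultimately show ?thesis
    by (simp only: abs_of_nonneg mult.commute)
qed

text \<open>Dividing the bound by \<open>h\<close> leaves an error of at most
  \<open>C * \<bar>h\<bar>\<close> in the difference quotient. For integrals this criterion takes
  the place of a dominated convergence argument.\<close>

lemma has_real_derivative_quadratic_remainder:
  fixes f :: "real \<Rightarrow> real"
  assumes "0 < d" and bound: "\<And>h. \<bar>h\<bar> < d \<Longrightarrow> \<bar>f (x + h) - f x - h * D\<bar> \<le> C * h\<^sup>2"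
  shows "(f has_real_derivative D) (at x)"
proof -
  have "\<forall>\<^sub>F h in at 0. norm ((f (x + h) - f x) / h - D) \<le> C * \<bar>h\<bar>"
    unfolding eventually_at
  proof (intro exI[of _ d] conjI ballI impI)
    fix h :: real
    assume "h \<noteq> 0 \<and> dist h 0 < d"
    then have h: "h \<noteq> 0" "\<bar>h\<bar> < d" by auto
    have "\<bar>h\<bar> * \<bar>(f (x + h) - f x) / h - D\<bar> = \<bar>f (x + h) - f x - h * D\<bar>"
      using h(1) by (simp add: abs_mult[symmetric] field_simps)
    also have "\<dots> \<le> \<bar>h\<bar> * (C * \<bar>h\<bar>)"
      using bound[OF h(2)] by (simp add: power2_eq_square mult.left_commute)
    finally show "norm ((f (x + h) - f x) / h - D) \<le> C * \<bar>h\<bar>"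
      using h(1) by simp
  qed (use \<open>0 < d\<close> in auto)
  moreover have "((\<lambda>h. C * \<bar>h\<bar>) \<longlongrightarrow> 0) (at (0::real))"
    by (auto intro!: tendsto_eq_intros)
  ultimately have "((\<lambda>h. (f (x + h) - f x) / h - D) \<longlongrightarrow> 0) (at 0)"
    by (rule Lim_null_comparison)
  then show ?thesis
    by (simp add: DERIV_def LIM_zero_iff)
qed

text \<open>The form with \<open>a\<close> and \<open>w\<close> covers two cases:
  \<open>a = 1\<close>, \<open>w = 1\<close> gives \<phi>, where the integral of
  \<open>exp (- y * s)\<close> alone may diverge at 0, and \<open>a = 0\<close>,
  \<open>w s = s\<close> gives the negative of the first derivative. The second-order moment
  \<open>int2\<close> controls the Taylor remainder.\<close>

lemma has_real_derivative_integral_exp: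
  fixes a w :: "real \<Rightarrow> real"
  assumes "0 < x"
    and pos: "\<And>s. s \<in> space \<mu> \<Longrightarrow> 0 < s" "\<And>s. s \<in> space \<mu> \<Longrightarrow> 0 \<le> w s"
    and int0: "\<And>y. 0 < y \<Longrightarrow> integrable \<mu> (\<lambda>s. a s - w s * exp (- y * s))"
    and int1: "integrable \<mu> (\<lambda>s. s * w s * exp (- x * s))"
    and int2: "integrable \<mu> (\<lambda>s. s\<^sup>2 * w s * exp (- (x / 2) * s))"
  shows "((\<lambda>y. \<integral>s. a s - w s * exp (- y * s) \<partial>\<mu>) has_real_derivative
    (\<integral>s. s * w s * exp (- x * s) \<partial>\<mu>)) (at x)"
proof (rule has_real_derivative_quadratic_remainder)
  show "0 < x / 2" using \<open>0 < x\<close> by simp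
  fix h :: real
  assume h: "\<bar>h\<bar> < x / 2"
  let ?f = "\<lambda>y s. a s - w s * exp (- y * s)"
  let ?R = "\<lambda>s. ?f (x + h) s - ?f x s - h * (s * w s * exp (- x * s))"
  have "0 < x + h" using h by linarith
  have "\<bar>(\<integral>s. ?f (x + h) s \<partial>\<mu>) - (\<integral>s. ?f x s \<partial>\<mu>) - h * (\<integral>s. s * w s * exp (- x * s) \<partial>\<mu>)\<bar>
      = \<bar>\<integral>s. ?R s \<partial>\<mu>\<bar>"
    using int0[OF \<open>0 < x + h\<close>] int0[OF \<open>0 < x\<close>] int1
    by (simp only: Bochner_Integration.integral_diff Bochner_Integration.integrable_diff
        integral_mult_right_zero integrable_mult_right)
  also have "\<dots> \<le> (\<integral>s. h\<^sup>2 * (s\<^sup>2 * w s * exp (- (x / 2) * s)) \<partial>\<mu>)"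
  proof (rule integral_abs_bound_integral)
    show "integrable \<mu> ?R"
      using int0[OF \<open>0 < x + h\<close>] int0[OF \<open>0 < x\<close>] int1
      by (simp only: Bochner_Integration.integrable_diff integrable_mult_right)
    show "integrable \<mu> (\<lambda>s. h\<^sup>2 * (s\<^sup>2 * w s * exp (- (x / 2) * s)))"
      using int2 by auto
    fix s
    assume "s \<in> space \<mu>"
    note s = pos[OF this]
    have "?R s = - (w s * exp (- x * s) * (exp (- h * s) - 1 - (- h * s)))"
      by (simp add: algebra_simps flip: exp_add)
    then have "\<bar>?R s\<bar> = w s * exp (- x * s) * \<bar>exp (- h * s) - 1 - (- h * s)\<bar>"
      using s(2) by (simp only: abs_minus_cancel abs_mult abs_exp_cancel abs_of_nonneg)
    also have "\<dots> \<le> w s * exp (- x * s) * ((- h * s)\<^sup>2 * exp \<bar>- h * s\<bar>)"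
      using s(2) by (intro mult_left_mono exp_quadratic_remainder) auto
    also have "\<dots> = h\<^sup>2 * (s\<^sup>2 * w s * exp (- x * s + \<bar>h\<bar> * s))"
      using s(1) unfolding exp_add by (simp add: abs_mult power_mult_distrib)
    \<comment> \<open>The remainder costs a factor \<open>exp (\<bar>h\<bar> * s)\<close>; as
      \<open>\<bar>h\<bar> < x / 2\<close>, half of the decay rate survives, uniformly in
      \<open>h\<close>.\<close>
    also have "\<dots> \<le> h\<^sup>2 * (s\<^sup>2 * w s * exp (- (x / 2) * s))"
    proof -
      have "\<bar>h\<bar> * s \<le> x / 2 * s"
        using h s(1) by (intro mult_right_mono) auto
      then show ?thesis
        using s(2) by (intro mult_left_mono) auto
    qed
    finally show "\<bar>?R s\<bar> \<le> h\<^sup>2 * (s\<^sup>2 * w s * exp (- (x / 2) * s))" .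
  qed
  also have "\<dots> = (\<integral>s. s\<^sup>2 * w s * exp (- (x / 2) * s) \<partial>\<mu>) * h\<^sup>2"
    by simp
  finally show "\<bar>(\<integral>s. ?f (x + h) s \<partial>\<mu>) - (\<integral>s. ?f x s \<partial>\<mu>) - h * (\<integral>s. s * w s * exp (- x * s) \<partial>\<mu>)\<bar>
      \<le> (\<integral>s. s\<^sup>2 * w s * exp (- (x / 2) * s) \<partial>\<mu>) * h\<^sup>2" .
qed

section \<open>Integrability with respect to a Levy measure\<close>

lemma levy_measure_space: "levy_measure \<mu> \<Longrightarrow> space \<mu> = {0<..}"
  unfolding levy_measure_def by (auto dest: sets_eq_imp_space_eq simp: space_restrict_space)

lemma levy_measure_measurable:
  fixes f :: "real \<Rightarrow> real"
  assumes "levy_measure \<mu>" "f \<in> borel_measurable borel"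
  shows "f \<in> borel_measurable \<mu>"
proof -
  have "sets \<mu> = sets (restrict_space borel {0<..})"
    using assms(1) by (simp add: levy_measure_def)
  then show ?thesis
    using measurable_restrict_space1[OF assms(2)] measurable_cong_sets by blast
qed

lemma levy_measure_integrable_bound:
  fixes f :: "real \<Rightarrow> real"
  assumes \<mu>: "levy_measure \<mu>" and f: "f \<in> borel_measurable borel"
    and bound: "\<And>s. 0 < s \<Longrightarrow> \<bar>f s\<bar> \<le> B * min 1 s"
  shows "integrable \<mu> f"
proof (rule Bochner_Integration.integrable_bound)
  have "(\<lambda>s::real. min 1 s) \<in> borel_measurable \<mu>"
    by (rule levy_measure_measurable[OF \<mu>]) simp
  moreover have "AE s in \<mu>. 0 \<le> min 1 s"
    by (auto simp: levy_measure_space[OF \<mu>])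
  ultimately have "integrable \<mu> (\<lambda>s. min 1 s)"
    using \<mu> unfolding levy_measure_def by (intro integrableI_nonneg) auto
  then show "integrable \<mu> (\<lambda>s. B * min 1 s)"
    by simp
  show "f \<in> borel_measurable \<mu>"
    by (rule levy_measure_measurable[OF \<mu> f])
  show "AE s in \<mu>. norm (f s) \<le> norm (B * min 1 s)"
    using bound by (force simp: levy_measure_space[OF \<mu>])
qed

lemma power_mult_exp_minus_le:
  fixes s c :: real
  assumes "0 \<le> s" "0 < c"
  shows "s ^ k * exp (- c * s) \<le> fact k / c ^ k"
proof -
  have "(c * s) ^ k / fact k \<le> exp (c * s)"
    using assms by (intro power_div_fact_le_exp) simp
  then show ?thesis
    using assms by (simp add: exp_minus field_simps power_mult_distrib)
qed

text \<open>At least one factor \<open>s\<close> must be present, hence \<open>Suc k\<close>: \<mu>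
  may have infinite mass near 0, where only \<open>min 1 s\<close> is known to be
  integrable.\<close>

lemma levy_measure_integrable_power_exp:
  assumes "levy_measure \<mu>" "0 < c"
  shows "integrable \<mu> (\<lambda>s. s ^ Suc k * exp (- c * s))"
proof (rule levy_measure_integrable_bound[OF assms(1)])
  \<comment> \<open>The first entry bounds the whole function and serves for large \<open>s\<close>;
    the second bounds what remains after one factor \<open>s\<close> is split off and serves for
    \<open>s \<le> 1\<close>.\<close>
  let ?B = "max (fact (Suc k) / c ^ Suc k) (fact k / c ^ k)"
  fix s :: real
  assume "0 < s"
  have "s ^ Suc k * exp (- c * s) \<le> ?B"
    using power_mult_exp_minus_le[of s c "Suc k"] \<open>0 < s\<close> \<open>0 < c\<close> by linarith
  moreover have "s ^ k * exp (- c * s) \<le> ?B"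
    using power_mult_exp_minus_le[of s c k] \<open>0 < s\<close> \<open>0 < c\<close> by linarith
  then have "s * (s ^ k * exp (- c * s)) \<le> s * ?B"
    using \<open>0 < s\<close> by (intro mult_left_mono) auto
  ultimately show "\<bar>s ^ Suc k * exp (- c * s)\<bar> \<le> ?B * min 1 s"
    using \<open>0 < s\<close> by (simp add: abs_mult min_def mult_ac)
qed measurable

lemma levy_measure_integrable_one_minus_exp:
  assumes "levy_measure \<mu>" "0 < c"
  shows "integrable \<mu> (\<lambda>s. 1 - exp (- c * s))"
proof (rule levy_measure_integrable_bound[OF assms(1)])
  fix s :: real
  assume "0 < s"
  have "0 \<le> c * s" using \<open>0 < s\<close> \<open>0 < c\<close> by simp
  moreover have "1 - exp (- c * s) \<le> c * s"
    using exp_ge_add_one_self[of "- c * s"] by simp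
  moreover have "c * s \<le> max 1 c * s"
    using \<open>0 < s\<close> by (intro mult_right_mono) auto
  moreover have "1 - exp (- c * s) \<le> max 1 c" by (simp add: le_max_iff_disj)
  ultimately show "\<bar>1 - exp (- c * s)\<bar> \<le> max 1 c * min 1 s"
    unfolding min_def by auto
qed measurable

section \<open>First and second derivatives of the Laplace exponent\<close>

lemma
  assumes \<mu>: "has_drift_levy_measure \<phi> 0 \<mu>" and "0 < x"
  shows laplace_exponent_has_real_derivative:
      "(\<phi> has_real_derivative (\<integral>s. s * exp (- x * s) \<partial>\<mu>)) (at x)"
    and deriv_laplace_exponent_has_real_derivative:
      "(deriv \<phi> has_real_derivative - (\<integral>s. s\<^sup>2 * exp (- x * s) \<partial>\<mu>)) (at x)"
proof -
  have levy: "levy_measure \<mu>" and \<phi>: "\<And>l. 0 < l \<Longrightarrow> \<phi> l = (\<integral>s. 1 - exp (- l * s) \<partial>\<mu>)"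
    using \<mu> by (auto simp: has_drift_levy_measure_def)
  note pos = levy_measure_space[OF levy]
  note int = levy_measure_integrable_power_exp[OF levy]
  have D: "(\<phi> has_real_derivative (\<integral>s. s * exp (- y * s) \<partial>\<mu>)) (at y)" if "0 < y" for y
  proof -
    have "((\<lambda>y. \<integral>s. 1 - 1 * exp (- y * s) \<partial>\<mu>) has_real_derivative
        (\<integral>s. s * 1 * exp (- y * s) \<partial>\<mu>)) (at y)"
      using that int[of y 0] int[of "y / 2" 1] levy_measure_integrable_one_minus_exp[OF levy]
      by (intro has_real_derivative_integral_exp) (auto simp: pos power2_eq_square)
    then have "((\<lambda>y. \<integral>s. 1 - exp (- y * s) \<partial>\<mu>) has_real_derivative
        (\<integral>s. s * exp (- y * s) \<partial>\<mu>)) (at y)"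
      by simp
    then show ?thesis
      \<comment> \<open>\<phi> agrees with the integral only on the open half-line, which suffices
        for a derivative at \<open>y > 0\<close>.\<close>
      by (rule has_field_derivative_transform_within_open[of _ _ _ "{0<..}"]) (use that \<phi> in auto)
  qed
  then show "(\<phi> has_real_derivative (\<integral>s. s * exp (- x * s) \<partial>\<mu>)) (at x)"
    using \<open>0 < x\<close> by blast
  \<comment> \<open>The case \<open>a = 0\<close>, \<open>w s = s\<close> differentiates the
    negative of the first derivative, so the sign is flipped afterwards. The hypotheses now involve
    the first three moments.\<close>
  have "((\<lambda>y. \<integral>s. 0 - s * exp (- y * s) \<partial>\<mu>) has_real_derivative
      (\<integral>s. s * s * exp (- x * s) \<partial>\<mu>)) (at x)"
    using \<open>0 < x\<close> int[of _ 0] int[of x 1] int[of "x / 2" 2]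
    by (intro has_real_derivative_integral_exp)
      (auto simp: pos power2_eq_square numeral_2_eq_2 mult.assoc)
  from DERIV_minus[OF this]
  have "((\<lambda>y. \<integral>s. s * exp (- y * s) \<partial>\<mu>) has_real_derivative
      - (\<integral>s. s\<^sup>2 * exp (- x * s) \<partial>\<mu>)) (at x)"
    by (simp add: power2_eq_square)
  then show "(deriv \<phi> has_real_derivative - (\<integral>s. s\<^sup>2 * exp (- x * s) \<partial>\<mu>)) (at x)"
    by (rule has_field_derivative_transform_within_open[of _ _ _ "{0<..}"])
      (use \<open>0 < x\<close> in \<open>auto simp: DERIV_imp_deriv[OF D]\<close>)
qed

section \<open>Comparison of \<open>H_of \<phi>\<close> with the second derivative\<close>

theorem proposition1p4:
  fixes P :: "'a measure" and S :: "real \<Rightarrow> 'a \<Rightarrow> real"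
    and \<phi> :: "real \<Rightarrow> real" and \<mu> :: "real measure" and \<gamma> l\<^sub>L C\<^sub>L :: real
  assumes "subordinator P S"
    and "laplace_exponent_of P S \<phi>"
    and "has_drift_levy_measure \<phi> 0 \<mu>"
    and "condition_L (H_of \<phi>) \<gamma> l\<^sub>L C\<^sub>L"
  shows "\<exists>M\<ge>1. comparable_on {M * l\<^sub>L<..} (H_of \<phi>) (\<lambda>x. x\<^sup>2 * (- deriv (deriv \<phi>) x))"
proof -
  have levy: "levy_measure \<mu>" and \<phi>: "\<And>l. 0 < l \<Longrightarrow> \<phi> l = (\<integral>s. 1 - exp (- l * s) \<partial>\<mu>)"
    using assms(3) by (auto simp: has_drift_levy_measure_def)
  have H_pos: "\<And>l. 0 < l \<Longrightarrow> 0 < H_of \<phi> l" and "0 < \<gamma>" "0 \<le> l\<^sub>L" "0 < C\<^sub>L"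
    and L: "\<And>l x. l\<^sub>L < l \<Longrightarrow> 1 \<le> x \<Longrightarrow> C\<^sub>L * x powr \<gamma> \<le> H_of \<phi> (l * x) / H_of \<phi> l"
    using assms(4) by (auto simp: condition_L_def)
  note space = levy_measure_space[OF levy]
  note int_exp = levy_measure_integrable_one_minus_exp[OF levy]
  note D1 = laplace_exponent_has_real_derivative[OF assms(3)]
  note D2 = deriv_laplace_exponent_has_real_derivative[OF assms(3)]
  \<comment> \<open>As an integral, the negative second derivative inherits its sign and
    monotonicity pointwise from the integrand.\<close>
  define g where "g l = (\<integral>s. s\<^sup>2 * exp (- l * s) \<partial>\<mu>)" for l
  have int1: "integrable \<mu> (\<lambda>s. s * exp (- l * s))" if "0 < l" for l
    using levy_measure_integrable_power_exp[OF levy that, of 0] by simp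
  have int2: "integrable \<mu> (\<lambda>s. s\<^sup>2 * exp (- l * s))" if "0 < l" for l
    using levy_measure_integrable_power_exp[OF levy that, of 1] by (simp add: power2_eq_square)
  have deriv2: "deriv (deriv \<phi>) l = - g l" if "0 < l" for l
    using DERIV_imp_deriv[OF D2[OF that]] by (simp add: g_def)
  \<comment> \<open>This holds for all real \<open>l\<close>: where the integrand is not integrable,
    the Bochner integral is 0.\<close>
  have g_nonneg: "0 \<le> g l" for l
    unfolding g_def by (intro integral_nonneg_AE) auto
  have g_antimono: "g m \<le> g l" if "0 < l" "l \<le> m" for l m
    unfolding g_def using that int2
    by (intro integral_mono mult_left_mono) (auto simp: space)

  have upper: "l\<^sup>2 * g l \<le> 2 * H_of \<phi> l" if "0 < l" for l
  proof -
    have "l\<^sup>2 * g l = (\<integral>s. l\<^sup>2 * (s\<^sup>2 * exp (- l * s)) \<partial>\<mu>)"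
      by (simp add: g_def)
    also have "\<dots> \<le> (\<integral>s. 2 * ((1 - exp (- l * s)) - l * (s * exp (- l * s))) \<partial>\<mu>)"
    proof (rule integral_mono)
      show "integrable \<mu> (\<lambda>s. l\<^sup>2 * (s\<^sup>2 * exp (- l * s)))"
        using int2[OF that] by (rule integrable_mult_right)
      show "integrable \<mu> (\<lambda>s. 2 * ((1 - exp (- l * s)) - l * (s * exp (- l * s))))"
        using int_exp[OF that] int1[OF that]
        by (simp only: Bochner_Integration.integrable_diff integrable_mult_right)
      fix s
      assume "s \<in> space \<mu>"
      then have "0 \<le> l * s" using that by (simp add: space)
      \<comment> \<open>With \<open>u = l * s\<close>, multiplying the quadratic Taylor bound by
        \<open>exp (- u)\<close> turns it into the required comparison of integrands.\<close>
      then have "(1 + l * s + (l * s)\<^sup>2 / 2) * exp (- l * s) \<le> exp (l * s) * exp (- l * s)"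
        by (intro mult_right_mono exp_lower_Taylor_quadratic) auto
      also have "\<dots> = 1"
        by (simp flip: exp_add)
      finally show "l\<^sup>2 * (s\<^sup>2 * exp (- l * s)) \<le> 2 * ((1 - exp (- l * s)) - l * (s * exp (- l * s)))"
        by (simp add: algebra_simps power_mult_distrib)
    qed
    also have "\<dots> = 2 * H_of \<phi> l"
      using int_exp[OF that] int1[OF that] \<phi>[OF that] DERIV_imp_deriv[OF D1[OF that]]
      by (simp only: H_of_def Bochner_Integration.integral_diff Bochner_Integration.integrable_diff
          integral_mult_right_zero integrable_mult_right)
    finally show ?thesis .
  qed

  \<comment> \<open>The second entry solves \<open>C\<^sub>L * K powr \<gamma> = 2\<close>, so that
    (L) at \<open>x = K\<close> doubles \<open>H_of \<phi>\<close>. The entry 2 makes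
    \<open>l < K * l\<close> and \<open>0 < K * (K - 1)\<close> immediate.\<close>
  define K where "K = max 2 ((2 / C\<^sub>L) powr (1 / \<gamma>))"
  have "2 \<le> K" by (simp add: K_def)
  have "2 / C\<^sub>L = ((2 / C\<^sub>L) powr (1 / \<gamma>)) powr \<gamma>"
    using \<open>0 < \<gamma>\<close> \<open>0 < C\<^sub>L\<close> by (simp add: powr_powr)
  also have "\<dots> \<le> K powr \<gamma>"
    using \<open>0 < \<gamma>\<close> by (intro powr_mono2) (auto simp: K_def)
  finally have K: "2 \<le> C\<^sub>L * K powr \<gamma>"
    using \<open>0 < C\<^sub>L\<close> by (simp add: field_simps)

  have lower: "H_of \<phi> l \<le> K * (K - 1) * (l\<^sup>2 * g l)" if "l\<^sub>L < l" for l
  proof -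
    have "0 < l" using that \<open>0 \<le> l\<^sub>L\<close> by simp
    then have "l < K * l" using \<open>2 \<le> K\<close> by simp
    \<comment> \<open>In the product rule the two first-derivative terms cancel, leaving only the
      second derivative.\<close>
    have "(H_of \<phi> has_real_derivative t * g t) (at t)" if "0 < t" for t
      unfolding H_of_def [abs_def] g_def
      using D1[OF that] D2[OF that] DERIV_imp_deriv[OF D1[OF that]]
      by (auto intro!: derivative_eq_intros)
    with \<open>0 < l\<close> obtain t where t: "l < t" "t < K * l"
      and mvt: "H_of \<phi> (K * l) - H_of \<phi> l = (K * l - l) * (t * g t)"
      using MVT2[OF \<open>l < K * l\<close>, of "H_of \<phi>" "\<lambda>t. t * g t"] by force
    have "2 \<le> H_of \<phi> (l * K) / H_of \<phi> l"
      using L[OF that, of K] K \<open>2 \<le> K\<close> by linarith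
    then have "H_of \<phi> l \<le> H_of \<phi> (K * l) - H_of \<phi> l"
      using H_pos[OF \<open>0 < l\<close>] by (simp add: field_simps)
    \<comment> \<open>The intermediate point lies in \<open>(l, K * l)\<close>: its upper end bounds
      the factor \<open>t\<close>, its lower end bounds \<open>g t\<close> by antitonicity.\<close>
    also have "\<dots> \<le> (K * l - l) * (K * l * g l)"
      unfolding mvt using t \<open>2 \<le> K\<close> \<open>0 < l\<close> g_nonneg g_antimono[OF \<open>0 < l\<close>, of t]
      by (intro mult_left_mono mult_mono) auto
    finally show ?thesis
      by (simp add: algebra_simps power2_eq_square)
  qed

  have "0 < K * (K - 1)" using \<open>2 \<le> K\<close> by simp
  \<comment> \<open>The factor 1 stays visible so that it can be read off as the witness for
    \<open>M\<close>. The comparison constants come from \<open>lower\<close> and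
    \<open>upper\<close>.\<close>
  have "comparable_on {1 * l\<^sub>L<..} (H_of \<phi>) (\<lambda>x. x\<^sup>2 * (- deriv (deriv \<phi>) x))"
    unfolding comparable_on_def
  proof (rule exI[of _ "1 / (K * (K - 1))"], intro conjI exI[of _ 2] ballI)
    fix l
    assume "l \<in> {1 * l\<^sub>L<..}"
    then have l: "l\<^sub>L < l" "0 < l" using \<open>0 \<le> l\<^sub>L\<close> by auto
    show "1 / (K * (K - 1)) * H_of \<phi> l \<le> l\<^sup>2 * (- deriv (deriv \<phi>) l)"
      using lower[OF l(1)] pos_divide_le_eq[OF \<open>0 < K * (K - 1)\<close>, of "H_of \<phi> l" "l\<^sup>2 * g l"]
      by (simp add: deriv2 l(2) mult.commute[of "l\<^sup>2 * g l"])
    show "l\<^sup>2 * (- deriv (deriv \<phi>) l) \<le> 2 * H_of \<phi> l"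
      using upper[OF l(2)] by (simp add: deriv2 l)
  qed (use \<open>0 < K * (K - 1)\<close> in auto)
  then show ?thesis by blast
qed

end
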